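(* For each $\phi\in C_\psi(X)$, the nonlinear evolution equation $$\frac{\partial}{\partial t}\phi_t(x)=-\phi_t(x)+(\Phi\phi_t)(x),\qquad \phi_0=\phi,$$ has a unique (classical) solution $[0,+\infty)\ni t\mapsto\phi_t\in C_\psi(X)$, and it satisfies $$c_\phi e^{-t}\psi(x)\le 1-\phi_t(x)\le\psi(x)$$ for all $t\ge0$ and $x\in X$. For $n_*<1$, this solution tends to $\phi_\infty(x)\equiv1$ as $t\to+\infty$ in the norm of $C_{\rm b}(X)$.
   Context: $X$ is a locally compact Polish space; $C_{\rm b}(X)$ is the Banach space of bounded continuous functions $X\to\mathbb{R}$ with the supremum norm, $C_{\rm b}^+(X)$ the set of its positive (nonnegative) elements. A configuration is a countable collection of points of $X$, multiple locations allowed, with only finitely many elements (with multiplicity) in each compact set; equivalently, a locally finite counting measure on $X$. $\Gamma$ is the set of all configurations with the vague topology (weakest making $\gamma\mapsto\sum_{x\in\gamma}g(x)$ continuous for all compactly supported continuous $g$); $\Gamma_0$ is the set of finite configurations, $|\xi|$ is the number of particles of $\xi\in\Gamma_0$, and $\Gamma^0$ is the singleton consisting of the empty configuration. Sums and products over a configuration count multiplicities; the empty product is $1$. A continuous function $\psi:X\to(0,1]$ is fixed which vanishes at infinity (for each $\varepsilon>0$ there is a compact $\Lambda_\varepsilon$ with $\psi<\varepsilon$ off $\Lambda_\varepsilon$) and satisfies $\inf_\Lambda\psi>0$ for each compact $\Lambda$. $b$ is a probability kernel: each $b_x$, $x\in X$, is a probability measure on $\Gamma$ with $b_x(\Gamma_0)=1$,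 and $x\mapsto b_x(\Xi)$ is measurable for each Borel $\Xi$. Put $\delta(x)=b_x(\Gamma^0)$, $n(x)=\int_{\Gamma_0}|\xi|\,b_x(d\xi)$, let $\beta^{(1)}_x$ be the measure on $X$ with $\int_\Gamma\big(\sum_{y\in\xi}h(y)\big)b_x(d\xi)=\int_Xh(y)\,\beta^{(1)}_x(dy)$, and $(\Phi\phi)(x)=\int_\Gamma\big(\prod_{y\in\xi}\phi(y)\big)b_x(d\xi)$. Standing assumptions: (i) $\Phi\phi\in C_{\rm b}(X)$ for each $\phi=e^{-g\psi}$ with $g\in C_{\rm b}^+(X)$; (ii) $n_*:=\sup_xn(x)<\infty$; (iii) there is a constant $\delta_*$ with $\delta(x)\ge1-\psi(x)\ge\delta_*>0$ for all $x\in X$; (iv) there is $m>0$ with $\int_X\psi(y)\beta_x^{(1)}(dy)\le n(x)\,m\,\psi(x)$ for all $x\in X$. $C_\psi(X)$ is the set of $\phi\in C_{\rm b}(X)$ for which there is a constant $c_\phi>0$ such that $c_\phi\psi(x)\le1-\phi(x)\le1-\delta(x)$ for all $x\in X$; for each $\phi\in C_\psi(X)$, $c_\phi$ denotes such a constant. A classical solution of the equation is a map $[0,+\infty)\ni t\mapsto\phi_t\in C_{\rm b}(X)$ which is everywhere continuously differentiable (in the norm of $C_{\rm b}(X)$) and satisfies both displayed equalities. *)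

theory Defs
  imports "HOL-Probability.Probability"
begin

section \<open>Configurations\<close>

text \<open>
  A configuration is encoded by its multiplicity function.  Countability of the support is not
  listed: it is automatic on a locally compact Polish space, which is \<open>\<sigma>\<close>-compact.
\<close>

definition configs :: "('a::topological_space \<Rightarrow> nat) set" where
  "configs = {\<gamma>. \<forall>K. compact K \<longrightarrow> finite {x\<in>K. \<gamma> x \<noteq> 0}}"

definition fin_configs :: "('a::topological_space \<Rightarrow> nat) set" where
  "fin_configs = {\<xi>. finite {x. \<xi> x \<noteq> 0}}"

definition empty_config :: "'a \<Rightarrow> nat" where
  "empty_config = (\<lambda>x. 0)"

text \<open>
  Only finitely many summands are nonzero when \<open>\<gamma>\<close> is finite, or when \<open>\<gamma>\<close> is locally finite and
  \<open>g\<close> has compact support.  The definition is used with values in \<^typ>\<open>real\<close> and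
  \<^typ>\<open>ennreal\<close>; in the latter every sum exists.
\<close>

definition config_sum ::
    "('a \<Rightarrow> nat) \<Rightarrow> ('a \<Rightarrow> 'b::{semiring_1,t2_space}) \<Rightarrow> 'b" where
  "config_sum \<gamma> g = (\<Sum>\<^sub>\<infinity>x. of_nat (\<gamma> x) * g x)"

text \<open>
  Only meaningful for finite configurations: HOL products over infinite sets are 1.  The
  offspring laws below give full mass to the finite configurations.
\<close>

definition config_prod :: "('a \<Rightarrow> nat) \<Rightarrow> ('a \<Rightarrow> real) \<Rightarrow> real" where
  "config_prod \<xi> f = (\<Prod>x\<in>{x. \<xi> x \<noteq> 0}. f x ^ \<xi> x)"

definition config_size :: "('a \<Rightarrow> nat) \<Rightarrow> nat" where
  "config_size \<xi> = (\<Sum>x\<in>{x. \<xi> x \<noteq> 0}. \<xi> x)"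

definition vague_topology :: "('a::topological_space \<Rightarrow> nat) topology" where
  "vague_topology = topology_generated_by
     {{\<gamma>\<in>configs. config_sum \<gamma> g \<in> U} | (g::'a \<Rightarrow> real) U.
        continuous_on UNIV g \<and> compact (closure {x. g x \<noteq> 0}) \<and> open U}"

definition vague_borel :: "('a::topological_space \<Rightarrow> nat) measure" where
  "vague_borel = sigma configs {U. openin vague_topology U}"


section \<open>Quantities attached to a branching kernel\<close>

definition death_prob :: "('a \<Rightarrow> ('a \<Rightarrow> nat) measure) \<Rightarrow> 'a \<Rightarrow> real" where
  "death_prob b x = measure (b x) {empty_config}"

definition mean_offspring ::
    "('a::topological_space \<Rightarrow> ('a \<Rightarrow> nat) measure) \<Rightarrow> 'a \<Rightarrow> ennreal" where
  "mean_offspring b x = (\<integral>\<^sup>+\<xi>\<in>fin_configs. of_nat (config_size \<xi>) \<partial>b x)"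

text \<open>
  The identity characterises each \<open>\<beta> x\<close> uniquely (take indicator functions for \<open>h\<close>).
\<close>

definition is_first_moment_kernel ::
    "('a::topological_space \<Rightarrow> ('a \<Rightarrow> nat) measure) \<Rightarrow> ('a \<Rightarrow> 'a measure) \<Rightarrow> bool" where
  "is_first_moment_kernel b \<beta> \<longleftrightarrow>
     (\<forall>x. sets (\<beta> x) = sets borel \<and>
          (\<forall>h::'a \<Rightarrow> ennreal. h \<in> borel_measurable borel \<longrightarrow>
             (\<integral>\<^sup>+\<xi>. config_sum \<xi> h \<partial>b x) = (\<integral>\<^sup>+y. h y \<partial>\<beta> x)))"

definition Phi ::
    "('a \<Rightarrow> ('a \<Rightarrow> nat) measure) \<Rightarrow> ('a \<Rightarrow> real) \<Rightarrow> 'a \<Rightarrow> real" where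
  "Phi b \<phi> x = (\<integral>\<xi>. config_prod \<xi> \<phi> \<partial>b x)"


section \<open>The evolution equation\<close>

definition C_psi ::
    "('a::topological_space \<Rightarrow> real) \<Rightarrow> ('a \<Rightarrow> ('a \<Rightarrow> nat) measure) \<Rightarrow> ('a \<Rightarrow>\<^sub>C real) set" where
  "C_psi \<psi> b = {\<phi> :: 'a \<Rightarrow>\<^sub>C real. \<exists>c>0. \<forall>x. c * \<psi> x \<le> 1 - \<phi> x \<and> 1 - \<phi> x \<le> 1 - death_prob b x}"

text \<open>
  Only the values \<open>u t\<close> with \<open>t \<ge> 0\<close> matter; the derivative is taken in the supremum norm and is
  one-sided at \<open>t = 0\<close>.
\<close>

definition classical_solution ::
    "('a::topological_space \<Rightarrow> ('a \<Rightarrow> nat) measure) \<Rightarrow> ('a \<Rightarrow>\<^sub>C real) \<Rightarrow>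
     (real \<Rightarrow> ('a \<Rightarrow>\<^sub>C real)) \<Rightarrow> bool" where
  "classical_solution b \<phi> u \<longleftrightarrow>
     u 0 = \<phi> \<and>
     (\<exists>u'. continuous_on {0..} u' \<and>
           (\<forall>t\<ge>0. (u has_vector_derivative u' t) (at t within {0..})) \<and>
           (\<forall>t\<ge>0. \<forall>x. u' t x = - u t x + Phi b (u t) x))"

end

theory Submission
  imports Defs
begin

text \<open>
  The product over a finite configuration is Lipschitz in \<open>\<phi>\<close> with constant the number of
  particles, so \<open>\<Phi>\<close> is \<open>n\<^sub>*\<close>-Lipschitz in the supremum norm on functions with values in \<open>[1 - \<psi>, 1]\<close>;
  these are exactly of the form \<open>e\<^sup>-\<^sup>g\<^sup>\<psi>\<close> with \<open>g\<close> bounded because \<open>1 - \<psi> \<ge> \<delta>\<^sub>*\<close>.  The Cauchy problem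
  with a truncated right-hand side thus has a global Picard solution.  Since
  \<open>\<delta> \<le> \<Phi>\<phi> \<le> 1\<close>, the relaxation \<open>\<partial>\<^sub>t(e\<^sup>t\<phi>\<^sub>t) = e\<^sup>t\<Phi>\<phi>\<^sub>t\<close> preserves \<open>\<delta> \<le> \<phi>\<^sub>t\<close> and
  \<open>e\<^sup>-\<^sup>t(1 - \<phi>) \<le> 1 - \<phi>\<^sub>t\<close>, hence the truncation is inactive.  Two solutions satisfy
  \<open>\<parallel>u\<^sub>t - v\<^sub>t\<parallel> \<le> e\<^bsup>(n\<^sub>* - 1)t\<^esup> \<parallel>u\<^sub>0 - v\<^sub>0\<parallel>\<close>, which gives uniqueness and, with \<open>v \<equiv> 1\<close>, the limit.
\<close>

text \<open>Lets the bounded continuous functions serve as state space in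
  \<open>lipschitz_ode_solution\<close>, which asks for a Banach space.\<close>

instance bcontfun :: (metric_space, banach) banach ..

section \<open>Ordinary differential equations in Banach spaces\<close>

text \<open>For k > L the weighted norm exp(-k s) |z(s)| has a maximum N on [0, t], attained at some
  t0, and the mean value inequality on [0, t0] gives N exp(k t0) - |z(0)| \<le> (L/k) N (exp(k t0) -
  1). Since L/k \<le> 1, this forces N \<le> |z(0)|. Maximising avoids differentiating the
  norm.\<close>

lemma gronwall_norm:
  fixes z :: "real \<Rightarrow> 'b::real_normed_vector"
  assumes L: "0 \<le> L"
    and z: "\<And>t. 0 \<le> t \<Longrightarrow> (z has_vector_derivative z' t) (at t within {0..})"
    and z': "\<And>t. 0 \<le> t \<Longrightarrow> norm (z' t) \<le> L * norm (z t)"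
    and t: "0 \<le> t"
  shows "norm (z t) \<le> exp (L * t) * norm (z 0)"
proof -
  \<comment> \<open>A rate strictly above \<open>L\<close> is positive even when
    \<open>L = 0\<close>, so division by it is safe; \<open>k\<close> tends to \<open>L\<close> only
    at the end.\<close>
  have bound: "norm (z t) \<le> exp (k * t) * norm (z 0)" if k: "L < k" for k
  proof -
    have cont: "continuous_on {0..} z"
      using z by (intro continuous_on_vector_derivative) auto
    have "continuous_on {0..t} (\<lambda>s. exp (- k * s) * norm (z s))"
      by (intro continuous_intros continuous_on_subset[OF cont]) auto
    then obtain t0 where t0: "t0 \<in> {0..t}"
      and max: "\<And>s. s \<in> {0..t} \<Longrightarrow> exp (- k * s) * norm (z s) \<le> exp (- k * t0) * norm (z t0)"
      using continuous_attains_sup[of "{0..t}" "\<lambda>s. exp (- k * s) * norm (z s)"] t by fastforce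
    define N where "N = exp (- k * t0) * norm (z t0)"
    have N0: "0 \<le> N" by (simp add: N_def)
    have kpos: "0 < k" using L k by linarith
    have zN: "norm (z s) \<le> N * exp (k * s)" if "s \<in> {0..t}" for s
      using max[OF that] by (simp add: N_def exp_minus field_simps)
    have "norm (z t0 - z 0) \<le> (L * N / k) * exp (k * t0) - (L * N / k) * exp (k * 0)"
    proof (cases "t0 = 0")
      case False
      with t0 have pos: "0 < t0" by auto
      show ?thesis
      proof (rule differentiable_bound_general[OF pos, where f' = z' and \<phi>' = "\<lambda>s. L * N * exp (k * s)"])
        show "continuous_on {0..t0} z" by (rule continuous_on_subset[OF cont]) auto
        show "continuous_on {0..t0} (\<lambda>s. L * N / k * exp (k * s))"
          by (intro continuous_intros)
        fix s assume s: "0 < s" "s < t0"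
        have "at s within {0..} = at s" using s by (intro at_within_interior) auto
        then show "(z has_vector_derivative z' s) (at s)" using z[of s] s by simp
        have "((\<lambda>s. L * N / k * exp (k * s)) has_real_derivative L * N * exp (k * s)) (at s)"
          using kpos by (auto intro!: derivative_eq_intros)
        then show "((\<lambda>s. L * N / k * exp (k * s)) has_vector_derivative L * N * exp (k * s)) (at s)"
          by (simp add: has_real_derivative_iff_has_vector_derivative)
        have "norm (z' s) \<le> L * norm (z s)" using z' s by simp
        also have "\<dots> \<le> L * (N * exp (k * s))"
          using s t0 L by (intro mult_left_mono zN) auto
        finally show "norm (z' s) \<le> L * N * exp (k * s)" by simp
      qed
    qed simp
    also have "\<dots> = (L / k) * (N * (exp (k * t0) - 1))" by (simp add: algebra_simps diff_divide_distrib)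
    also have "\<dots> \<le> 1 * (N * (exp (k * t0) - 1))"
      using k kpos t0 N0 by (intro mult_right_mono mult_nonneg_nonneg) auto
    finally have "norm (z t0) - norm (z 0) \<le> N * exp (k * t0) - N"
      using norm_triangle_ineq2[of "z t0" "z 0"] by (simp add: algebra_simps)
    moreover have "norm (z t0) = N * exp (k * t0)" by (simp add: N_def exp_minus)
    ultimately have "N \<le> norm (z 0)" by simp
    then have "N * exp (k * t) \<le> norm (z 0) * exp (k * t)" by (intro mult_right_mono) auto
    with zN[of t] t have "norm (z t) \<le> norm (z 0) * exp (k * t)" by (metis atLeastAtMost_iff order_trans order_refl)
    then show ?thesis by (simp add: mult.commute)
  qed
  have "((\<lambda>k. exp (k * t) * norm (z 0)) \<longlongrightarrow> exp (L * t) * norm (z 0)) (at_right L)"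
    by (intro tendsto_intros)
  moreover have "\<forall>\<^sub>F k in at_right L. norm (z t) \<le> exp (k * t) * norm (z 0)"
    using bound by (auto simp: eventually_at_right_field intro: exI[of _ "L + 1"])
  ultimately show ?thesis by (rule tendsto_lowerbound) simp
qed

text \<open>Integration against the exponential weight gains a factor 1/k, the source of the
  contraction constant of the Picard operator.\<close>

lemma norm_integral_le_exp:
  fixes g :: "real \<Rightarrow> 'b::banach"
  assumes "continuous_on {0..t} g" "\<And>s. s \<in> {0..t} \<Longrightarrow> norm (g s) \<le> C * exp (k * s)" "0 < k" "0 \<le> t"
  shows "norm (integral {0..t} g) \<le> C / k * (exp (k * t) - 1)"
proof -
  have "((\<lambda>s. C * exp (k * s)) has_integral (C / k * exp (k * t) - C / k * exp (k * 0))) {0..t}"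
  proof (rule fundamental_theorem_of_calculus)
    fix s
    have "((\<lambda>s. C / k * exp (k * s)) has_real_derivative C * exp (k * s)) (at s within {0..t})"
      using assms by (auto intro!: derivative_eq_intros)
    then show "((\<lambda>s. C / k * exp (k * s)) has_vector_derivative C * exp (k * s)) (at s within {0..t})"
      by (simp add: has_real_derivative_iff_has_vector_derivative)
  qed (use assms in auto)
  note h = this
  have "norm (integral {0..t} g) \<le> integral {0..t} (\<lambda>s. C * exp (k * s))"
    by (rule integral_norm_bound_integral)
      (use h assms in \<open>auto intro: integrable_continuous_real\<close>)
  also have "\<dots> = C / k * (exp (k * t) - 1)"
    using integral_unique[OF h] by (simp add: right_diff_distrib)
  finally show ?thesis .
qed

lemma integral_has_vector_derivative_atLeast:
  fixes g :: "real \<Rightarrow> 'b::banach"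
  assumes "continuous_on {0..} g" "0 \<le> t"
  shows "((\<lambda>r. integral {0..r} g) has_vector_derivative g t) (at t within {0..})"
proof -
  \<comment> \<open>The endpoint \<open>t + 1\<close> leaves room to the right of \<open>t\<close>,
    so the filters on \<open>{0..t + 1}\<close> and on \<open>{0..}\<close> agree at
    \<open>t\<close>.\<close>
  have "((\<lambda>r. integral {0..r} g) has_vector_derivative g t) (at t within {0..t + 1})"
    using assms by (intro integral_has_vector_derivative) (auto elim: continuous_on_subset)
  moreover have "at t within {0..t + 1} = at t within {0..}"
    by (rule at_within_nhd[of _ "{..<t + 1}"]) auto
  ultimately show ?thesis by simp
qed

text \<open>
  The Picard operator is a contraction for the weighted norm \<open>sup\<^sub>t e\<^sup>-\<^sup>k\<^sup>t \<parallel>u t\<parallel>\<close>; the fixed point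
  \<open>v\<close> below is the solution divided by the weight.
\<close>

lemma lipschitz_ode_solution:
  fixes f :: "'b::banach \<Rightarrow> 'b"
  assumes lip: "M-lipschitz_on UNIV f"
  obtains u where "u 0 = x0" "\<And>t. 0 \<le> t \<Longrightarrow> (u has_vector_derivative f (u t)) (at t within {0..})"
proof -
  \<comment> \<open>Any \<open>k > M\<close> makes \<open>M / k < 1\<close>; adding 1 also keeps
    \<open>k\<close> positive when \<open>M = 0\<close>.\<close>
  define k where "k = M + 1"
  have M0: "0 \<le> M" using lip by (rule lipschitz_on_nonneg)
  then have k: "0 < k" "M < k" by (auto simp: k_def)
  have lipD: "norm (f x - f y) \<le> M * norm (x - y)" for x y
    using lipschitz_onD[OF lip, of x y] by (simp add: dist_norm)
  have fcont: "continuous_on UNIV f" using lip by (rule lipschitz_on_continuous_on)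
  define g where "g v s = f (exp (k * s) *\<^sub>R apply_bcontfun v s)" for v :: "real \<Rightarrow>\<^sub>C 'b" and s
  have gcont: "continuous_on A (g v)" for A v
    unfolding g_def by (rule continuous_on_compose2[OF fcont]) (intro continuous_intros, auto)
  \<comment> \<open>Elements of \<open>real \<Rightarrow>\<^sub>C 'b\<close> live on the whole line,
    so negative times are folded onto 0 by \<open>max\<close>.\<close>
  define S where "S v t = x0 + integral {0..max 0 t} (g v)" for v t
  define T where "T v t = exp (- k * max 0 t) *\<^sub>R S v t" for v t
  have deriv: "((\<lambda>r. integral {0..r} (g v)) has_vector_derivative g v t) (at t within {0..})"
    if "0 \<le> t" for v t
    using that by (intro integral_has_vector_derivative_atLeast gcont)
  have intcont: "continuous_on {0..} (\<lambda>r. integral {0..r} (g v))" for v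
    by (rule continuous_on_vector_derivative) (rule deriv, simp)
  have Scont: "continuous_on UNIV (S v)" for v
  proof -
    have "continuous_on UNIV (\<lambda>t::real. max 0 t)" by (intro continuous_intros)
    then have "continuous_on UNIV (\<lambda>t. integral {0..max 0 t} (g v))"
      by (rule continuous_on_compose2[OF intcont[of v]]) auto
    then show ?thesis
      unfolding S_def by (rule continuous_on_add[OF continuous_on_const])
  qed
  have Tb: "T v \<in> bcontfun" for v
  proof (rule bcontfun_normI)
    show "continuous_on UNIV (T v)"
      unfolding T_def by (intro continuous_intros Scont)
    \<comment> \<open>Linear growth of \<open>f\<close>; the part \<open>norm (f 0)\<close> is
      absorbed into the weight because exp(k s) \<ge> 1.\<close>
    define C where "C = norm (f 0) + M * norm v"
    have C0: "0 \<le> C" using M0 by (simp add: C_def)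
    fix t :: real
    define r where "r = max 0 t"
    have r: "0 \<le> r" by (simp add: r_def)
    have "norm (integral {0..r} (g v)) \<le> C / k * (exp (k * r) - 1)"
    proof (rule norm_integral_le_exp[OF gcont _ k(1) r])
      fix s assume s: "s \<in> {0..r}"
      then have e1: "1 \<le> exp (k * s)" using k by simp
      have "norm (g v s) \<le> norm (f 0) + norm (f (exp (k * s) *\<^sub>R v s) - f 0)"
        unfolding g_def by (rule norm_triangle_sub)
      also have "\<dots> \<le> norm (f 0) + M * (exp (k * s) * norm (v s))"
        using lipD[of "exp (k * s) *\<^sub>R v s" 0] by simp
      also have "\<dots> \<le> norm (f 0) * exp (k * s) + M * (exp (k * s) * norm v)"
        using e1 M0 by (intro add_mono mult_left_mono norm_bounded) (auto simp: mult_le_cancel_left1)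
      finally show "norm (g v s) \<le> C * exp (k * s)" by (simp add: C_def algebra_simps)
    qed
    also have "\<dots> \<le> C / k * exp (k * r)" using C0 k by (intro mult_left_mono) auto
    finally have "norm (S v t) \<le> norm x0 + C / k * exp (k * r)"
      unfolding S_def r_def[symmetric] by (intro norm_triangle_le) auto
    also have "\<dots> \<le> norm x0 * exp (k * r) + C / k * exp (k * r)"
      using k r by (intro add_mono) (auto simp: mult_le_cancel_left1)
    finally show "norm (T v t) \<le> norm x0 + C / k"
      unfolding T_def r_def[symmetric] by (simp add: exp_minus field_simps)
  qed
  define B where "B v = Bcontfun (T v)" for v
  have B: "apply_bcontfun (B v) = T v" for v
    using Tb by (simp add: B_def Bcontfun_inverse)
  have "dist (B v) (B w) \<le> (M / k) * dist v w" for v w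
  proof (rule dist_bound)
    fix t :: real
    define r where "r = max 0 t"
    have r: "0 \<le> r" by (simp add: r_def)
    have int: "g y integrable_on {0..r}" for y
      by (intro integrable_continuous_real gcont)
    have "norm (S v t - S w t) = norm (integral {0..r} (\<lambda>s. g v s - g w s))"
      unfolding S_def r_def[symmetric] using int by (simp add: integral_diff)
    also have "\<dots> \<le> (M * dist v w) / k * (exp (k * r) - 1)"
    proof (rule norm_integral_le_exp[OF _ _ k(1) r])
      show "continuous_on {0..r} (\<lambda>s. g v s - g w s)" by (intro continuous_intros gcont)
      fix s
      have "norm (g v s - g w s) \<le> M * norm (exp (k * s) *\<^sub>R v s - exp (k * s) *\<^sub>R w s)"
        unfolding g_def by (rule lipD)
      also have "\<dots> = M * (exp (k * s) * dist (v s) (w s))"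
        by (simp add: dist_norm flip: scaleR_diff_right)
      also have "\<dots> \<le> M * (exp (k * s) * dist v w)"
        using M0 by (intro mult_left_mono dist_bounded) auto
      finally show "norm (g v s - g w s) \<le> M * dist v w * exp (k * s)" by (simp add: ac_simps)
    qed
    also have "\<dots> \<le> (M * dist v w) / k * exp (k * r)"
      using M0 k by (intro mult_left_mono) auto
    finally have "exp (- k * r) * norm (S v t - S w t) \<le> M / k * dist v w"
      by (simp add: exp_minus field_simps)
    then show "dist (apply_bcontfun (B v) t) (apply_bcontfun (B w) t) \<le> M / k * dist v w"
      unfolding B T_def r_def[symmetric] by (simp add: dist_norm flip: scaleR_diff_right)
  qed
  then obtain v where v: "B v = v"
    using banach_fix_type[of "M / k" B] M0 k by (auto simp: field_simps)
  \<comment> \<open>At the fixed point the weights cancel, so \<open>S v\<close> solves the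
    unweighted integral equation.\<close>
  have gS: "g v t = f (S v t)" if "0 \<le> t" for t
  proof -
    have "v t = exp (- k * t) *\<^sub>R S v t" using B[of v] that by (simp add: v T_def)
    then show ?thesis by (simp add: g_def flip: exp_add)
  qed
  show thesis
  proof (rule that)
    show "S v 0 = x0" by (simp add: S_def)
    fix t :: real assume t: "0 \<le> t"
    have "((\<lambda>r. x0 + integral {0..r} (g v)) has_vector_derivative g v t) (at t within {0..})"
      using deriv[OF t, of v] by (auto intro!: derivative_eq_intros)
    then have "(S v has_vector_derivative g v t) (at t within {0..})"
      by (rule has_vector_derivative_transform[rotated 2]) (use t in \<open>auto simp: S_def\<close>)
    then show "(S v has_vector_derivative f (S v t)) (at t within {0..})"
      using gS[OF t] by simp
  qed
qed

section \<open>Configurations and branching kernels\<close>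

lemma openin_vague_subset: "{U. openin vague_topology U} \<subseteq> Pow configs"
proof -
  have "topspace vague_topology \<subseteq> configs"
    unfolding vague_topology_def topology_generated_by_topspace by auto
  then show ?thesis using openin_subset by blast
qed

lemma space_vague_borel: "space vague_borel = configs"
  unfolding vague_borel_def by (rule space_measure_of[OF openin_vague_subset])

lemma openin_vague_sets: "openin vague_topology U \<Longrightarrow> U \<in> sets vague_borel"
  unfolding vague_borel_def by (rule in_measure_of[OF openin_vague_subset]) simp

lemma config_sum_finite:
  assumes "\<xi> \<in> fin_configs"
  shows "config_sum \<xi> g = (\<Sum>x\<in>{x. \<xi> x \<noteq> 0}. of_nat (\<xi> x) * g x)"
proof -
  have "config_sum \<xi> g = (\<Sum>\<^sub>\<infinity>x\<in>{x. \<xi> x \<noteq> 0}. of_nat (\<xi> x) * g x)"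
    unfolding config_sum_def by (rule infsum_cong_neutral) auto
  then show ?thesis using assms by (simp add: fin_configs_def)
qed

text \<open>Preimages of open sets are the very generators of the vague topology.\<close>

lemma measurable_config_sum_compact_support:
  fixes g :: "'a::topological_space \<Rightarrow> real"
  assumes "continuous_on UNIV g" "compact (closure {x. g x \<noteq> 0})"
  shows "(\<lambda>\<xi>. config_sum \<xi> g) \<in> borel_measurable vague_borel"
proof (rule borel_measurableI)
  fix S :: "real set" assume "open S"
  then have "openin vague_topology {\<gamma> \<in> configs. config_sum \<gamma> g \<in> S}"
    unfolding vague_topology_def using assms by (intro topology_generated_by_Basis) blast
  moreover have "(\<lambda>\<xi>. config_sum \<xi> g) -` S \<inter> space vague_borel = {\<gamma> \<in> configs. config_sum \<gamma> g \<in> S}"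
    by (auto simp: space_vague_borel)
  ultimately show "(\<lambda>\<xi>. config_sum \<xi> g) -` S \<inter> space vague_borel \<in> sets vague_borel"
    by (simp add: openin_vague_sets)
qed

text \<open>The superlevel sets of \<open>\<psi>\<close> form a compact exhaustion, which provides the cutoff functions.\<close>

lemma measurable_config_sum_fin_configs:
  fixes \<psi> h :: "'a::t2_space \<Rightarrow> real"
  assumes psi: "continuous_on UNIV \<psi>" "\<And>x. 0 < \<psi> x"
    and vanish: "\<And>\<epsilon>. \<epsilon> > 0 \<Longrightarrow> \<exists>\<Lambda>. compact \<Lambda> \<and> (\<forall>x. x \<notin> \<Lambda> \<longrightarrow> \<psi> x < \<epsilon>)"
    and fin: "fin_configs \<in> sets (vague_borel :: ('a \<Rightarrow> nat) measure)"
    and h: "continuous_on UNIV h"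
  shows "(\<lambda>\<xi>. if \<xi> \<in> fin_configs then config_sum \<xi> h else 0) \<in> borel_measurable vague_borel"
proof (rule borel_measurable_LIMSEQ_real)
  \<comment> \<open>A continuous cutoff: \<open>\<eta> n\<close> is 0 where n \<psi> \<le> 1 and 1
    where n \<psi> \<ge> 2. On a fixed finite configuration it is eventually 1 at every particle, so
    the sums with cutoff converge.\<close>
  define \<eta> where "\<eta> n y = max 0 (min 1 (real n * \<psi> y - 1))" for n y
  show "(\<lambda>\<xi>. if \<xi> \<in> fin_configs then config_sum \<xi> (\<lambda>y. \<eta> n y * h y) else 0) \<in> borel_measurable vague_borel"
    for n
  proof (rule measurable_If_set[OF measurable_config_sum_compact_support])
    show "continuous_on UNIV (\<lambda>y. \<eta> n y * h y)"
      unfolding \<eta>_def by (intro continuous_intros psi h)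
    have "{x. \<eta> n x * h x \<noteq> 0} \<subseteq> {x. 1 \<le> real n * \<psi> x}" by (auto simp: \<eta>_def)
    moreover have "closed {x. 1 \<le> real n * \<psi> x}"
      by (intro closed_Collect_le continuous_intros psi)
    ultimately have sub: "closure {x. \<eta> n x * h x \<noteq> 0} \<subseteq> {x. 1 \<le> real n * \<psi> x}"
      by (rule closure_minimal)
    show "compact (closure {x. \<eta> n x * h x \<noteq> 0})"
    proof (cases "n = 0")
      case True
      with sub have "closure {x. \<eta> n x * h x \<noteq> 0} = {}" by auto
      then show ?thesis by simp
    next
      case False
      then obtain \<Lambda> where \<Lambda>: "compact \<Lambda>" "\<And>x. x \<notin> \<Lambda> \<Longrightarrow> \<psi> x < 1 / real n"
        using vanish[of "1 / real n"] by auto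
      have "{x. 1 \<le> real n * \<psi> x} \<subseteq> \<Lambda>"
      proof
        fix x assume "x \<in> {x. 1 \<le> real n * \<psi> x}"
        then have "\<not> \<psi> x < 1 / real n" using False by (simp add: field_simps)
        then show "x \<in> \<Lambda>" using \<Lambda>(2) by blast
      qed
      then have "closure {x. \<eta> n x * h x \<noteq> 0} = \<Lambda> \<inter> closure {x. \<eta> n x * h x \<noteq> 0}" using sub by auto
      then show ?thesis using compact_Int_closed[OF \<Lambda>(1) closed_closure] by metis
    qed
  qed (use fin in auto)
  fix \<xi> :: "'a \<Rightarrow> nat"
  show "(\<lambda>n. if \<xi> \<in> fin_configs then config_sum \<xi> (\<lambda>y. \<eta> n y * h y) else 0)
          \<longlonglongrightarrow> (if \<xi> \<in> fin_configs then config_sum \<xi> h else 0)"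
  proof (cases "\<xi> \<in> fin_configs")
    case True
    have "(\<lambda>n. \<eta> n x) \<longlonglongrightarrow> 1" for x
    proof (rule tendsto_eventually)
      obtain N :: nat where N: "2 / \<psi> x < real N" using reals_Archimedean2 by blast
      have "\<eta> n x = 1" if "n \<ge> N" for n
      proof -
        have "2 / \<psi> x < real n" using N that by linarith
        then have "2 < real n * \<psi> x" using psi(2)[of x] by (simp add: field_simps)
        then show ?thesis by (simp add: \<eta>_def)
      qed
      then show "\<forall>\<^sub>F n in sequentially. \<eta> n x = 1" by (auto simp: eventually_sequentially)
    qed
    then have "(\<lambda>n. \<Sum>x\<in>{x. \<xi> x \<noteq> 0}. of_nat (\<xi> x) * (\<eta> n x * h x))
        \<longlonglongrightarrow> (\<Sum>x\<in>{x. \<xi> x \<noteq> 0}. of_nat (\<xi> x) * (1 * h x))"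
      by (intro tendsto_intros)
    then show ?thesis using True by (simp add: config_sum_finite)
  qed simp
qed

text \<open>As \<open>f\<close> is positive, the product is the exponential of the sum of ln f. On
  an infinite support the product defaults to 1, matching exp of the default 0 for the sum.\<close>

lemma measurable_config_prod:
  fixes \<psi> f :: "'a::t2_space \<Rightarrow> real"
  assumes psi: "continuous_on UNIV \<psi>" "\<And>x. 0 < \<psi> x"
    and vanish: "\<And>\<epsilon>. \<epsilon> > 0 \<Longrightarrow> \<exists>\<Lambda>. compact \<Lambda> \<and> (\<forall>x. x \<notin> \<Lambda> \<longrightarrow> \<psi> x < \<epsilon>)"
    and fin: "fin_configs \<in> sets (vague_borel :: ('a \<Rightarrow> nat) measure)"
    and f: "continuous_on UNIV f" "\<And>x. 0 < f x"
  shows "(\<lambda>\<xi>. config_prod \<xi> f) \<in> borel_measurable vague_borel"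
proof -
  have "config_prod \<xi> f = exp (if \<xi> \<in> fin_configs then config_sum \<xi> (\<lambda>x. ln (f x)) else 0)" for \<xi>
  proof (cases "\<xi> \<in> fin_configs")
    case True
    then have "finite {x. \<xi> x \<noteq> 0}" by (simp add: fin_configs_def)
    then show ?thesis
      using True f(2) by (simp add: config_sum_finite config_prod_def exp_sum exp_of_nat_mult)
  qed (simp add: config_prod_def fin_configs_def)
  moreover have "(\<lambda>\<xi>. if \<xi> \<in> fin_configs then config_sum \<xi> (\<lambda>x. ln (f x)) else 0) \<in> borel_measurable vague_borel"
    using f(2) by (intro measurable_config_sum_fin_configs[OF psi vanish fin] continuous_on_ln f(1))
       (auto simp: less_imp_neq[symmetric])
  ultimately show ?thesis by simp
qed

section \<open>Bounds and Lipschitz estimates for products and for \<Phi>\<close>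

lemma config_prod_bounds:
  assumes "\<And>x. 0 \<le> f x \<and> f x \<le> 1"
  shows "0 \<le> config_prod \<xi> f" "config_prod \<xi> f \<le> 1"
  using assms unfolding config_prod_def by (auto intro!: prod_nonneg prod_le_1 simp: power_le_one)

text \<open>Exchange one factor at a time: the other factors lie in [0, 1], so each exchange costs
  at most \<open>d\<close>, and a point of multiplicity k is exchanged k times.\<close>

lemma config_prod_diff_le:
  assumes \<xi>: "\<xi> \<in> fin_configs"
    and f: "\<And>x. 0 \<le> f x \<and> f x \<le> 1" and g: "\<And>x. 0 \<le> g x \<and> g x \<le> 1"
    and d: "\<And>x. \<bar>f x - g x\<bar> \<le> d"
  shows "\<bar>config_prod \<xi> f - config_prod \<xi> g\<bar> \<le> real (config_size \<xi>) * d"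
proof -
  have "norm (config_prod \<xi> f - config_prod \<xi> g) \<le> (\<Sum>x\<in>{x. \<xi> x \<noteq> 0}. norm (f x ^ \<xi> x - g x ^ \<xi> x))"
    unfolding config_prod_def using f g by (intro norm_prod_diff) (auto simp: power_le_one)
  also have "\<dots> \<le> (\<Sum>x\<in>{x. \<xi> x \<noteq> 0}. real (\<xi> x) * d)"
  proof (rule sum_mono)
    fix x
    have "norm (f x ^ \<xi> x - g x ^ \<xi> x) \<le> real (\<xi> x) * norm (f x - g x)"
      using f[of x] g[of x] by (intro norm_power_diff) auto
    also have "\<dots> \<le> real (\<xi> x) * d" using d[of x] by (intro mult_left_mono) auto
    finally show "norm (f x ^ \<xi> x - g x ^ \<xi> x) \<le> real (\<xi> x) * d" .
  qed
  finally show ?thesis by (simp add: config_size_def sum_distrib_right)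
qed

lemma config_prod_one: "config_prod \<xi> (\<lambda>_. 1) = 1"
  by (simp add: config_prod_def)

lemma config_prod_empty: "config_prod empty_config f = 1"
  by (simp add: config_prod_def empty_config_def)

text \<open>The lower bound comes from the empty configuration, whose product is 1: the indicator of
  that singleton lies below the product.\<close>

lemma Phi_bounds:
  fixes b :: "'a \<Rightarrow> ('a \<Rightarrow> nat) measure"
  assumes M: "prob_space (b x)"
    and meas: "(\<lambda>\<xi>. config_prod \<xi> f) \<in> borel_measurable (b x)"
    and f: "\<And>y. 0 \<le> f y \<and> f y \<le> 1"
  shows "death_prob b x \<le> Phi b f x" "Phi b f x \<le> 1"
proof -
  interpret prob_space "b x" by (rule M)
  have int: "integrable (b x) (\<lambda>\<xi>. config_prod \<xi> f)"
    by (rule integrable_const_bound[of _ 1]) (use config_prod_bounds[of f] f meas in auto)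
  show "Phi b f x \<le> 1"
    unfolding Phi_def using int config_prod_bounds(2)[of f] f
    by (intro order_trans[OF integral_mono[OF int integrable_const]]) (auto simp: prob_space)
  show "death_prob b x \<le> Phi b f x"
  proof (cases "{empty_config} \<in> sets (b x)")
    case True
    have "death_prob b x = (\<integral>\<xi>. indicator {empty_config} \<xi> \<partial>b x)"
      using True by (simp add: death_prob_def)
    also have "\<dots> \<le> (\<integral>\<xi>. config_prod \<xi> f \<partial>b x)"
      using True config_prod_bounds(1)[of f] f
      by (intro integral_mono int) (auto simp: config_prod_empty integrable_indicator_iff emeasure_eq_measure split: split_indicator)
    finally show ?thesis by (simp add: Phi_def)
  next
    case False
    \<comment> \<open>Outside the \<sigma>-algebra \<open>measure\<close> returns 0, so only
      nonnegativity remains to be shown.\<close>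
    then have "death_prob b x = 0" by (simp add: death_prob_def measure_notin_sets)
    also have "0 \<le> Phi b f x"
      unfolding Phi_def using config_prod_bounds(1)[of f] f by (intro integral_nonneg_AE) auto
    finally show ?thesis .
  qed
qed

text \<open>Integrating \<open>config_prod_diff_le\<close> turns the number of particles into the
  mean offspring; the configurations that are not finite form a null set.\<close>

lemma Phi_diff_le:
  fixes b :: "'a::topological_space \<Rightarrow> ('a \<Rightarrow> nat) measure"
  assumes M: "prob_space (b x)" and fin: "measure (b x) fin_configs = 1"
    and measf: "(\<lambda>\<xi>. config_prod \<xi> f) \<in> borel_measurable (b x)"
    and measg: "(\<lambda>\<xi>. config_prod \<xi> g) \<in> borel_measurable (b x)"
    and size: "(\<lambda>\<xi>. of_nat (config_size \<xi>) * indicator fin_configs \<xi> :: ennreal) \<in> borel_measurable (b x)"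
    and f: "\<And>y. 0 \<le> f y \<and> f y \<le> 1" and g: "\<And>y. 0 \<le> g y \<and> g y \<le> 1"
    and d: "\<And>y. \<bar>f y - g y\<bar> \<le> d" "0 \<le> d"
    and L: "mean_offspring b x \<le> ennreal L" "0 \<le> L"
  shows "\<bar>Phi b f x - Phi b g x\<bar> \<le> L * d"
proof -
  interpret prob_space "b x" by (rule M)
  have int: "integrable (b x) (\<lambda>\<xi>. config_prod \<xi> f)" "integrable (b x) (\<lambda>\<xi>. config_prod \<xi> g)"
    by (rule integrable_const_bound[of _ 1], use config_prod_bounds[of f] config_prod_bounds[of g] f g measf measg in auto)+
  \<comment> \<open>In \<open>ennreal\<close> the integral of the particle number exists without an
    integrability check.\<close>
  have "ennreal (norm (Phi b f x - Phi b g x)) = ennreal (norm (\<integral>\<xi>. config_prod \<xi> f - config_prod \<xi> g \<partial>b x))"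
    using int by (simp add: Phi_def)
  also have "\<dots> \<le> (\<integral>\<^sup>+\<xi>. ennreal (norm (config_prod \<xi> f - config_prod \<xi> g)) \<partial>b x)"
    using int by (intro integral_norm_bound_ennreal) auto
  also have "\<dots> \<le> (\<integral>\<^sup>+\<xi>. of_nat (config_size \<xi>) * indicator fin_configs \<xi> * ennreal d \<partial>b x)"
  proof (rule nn_integral_mono_AE)
    show "AE \<xi> in b x. ennreal (norm (config_prod \<xi> f - config_prod \<xi> g))
        \<le> of_nat (config_size \<xi>) * indicator fin_configs \<xi> * ennreal d"
      using AE_prob_1[OF fin]
    proof (rule AE_mp, intro AE_I2 impI)
      fix \<xi> :: "'a \<Rightarrow> nat" assume \<xi>: "\<xi> \<in> fin_configs"
      have "ennreal (norm (config_prod \<xi> f - config_prod \<xi> g)) \<le> ennreal (real (config_size \<xi>) * d)"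
        using config_prod_diff_le[OF \<xi> f g d(1)] by (intro ennreal_leI) simp
      then show "ennreal (norm (config_prod \<xi> f - config_prod \<xi> g))
        \<le> of_nat (config_size \<xi>) * indicator fin_configs \<xi> * ennreal d"
        using \<xi> d by (simp add: ennreal_mult ennreal_of_nat_eq_real_of_nat)
    qed
  qed
  also have "\<dots> = mean_offspring b x * ennreal d"
    unfolding mean_offspring_def by (rule nn_integral_multc[OF size])
  also have "\<dots> \<le> ennreal (L * d)"
    using L d by (simp add: ennreal_mult mult_right_mono)
  finally show ?thesis using L d by (simp add: ennreal_le_iff)
qed

section \<open>The evolution equation\<close>

text \<open>Turns a derivative in the supremum norm into a derivative at each point, so that scalar
  arguments apply.\<close>

lemma bounded_linear_apply_bcontfun:
  "bounded_linear (\<lambda>u :: 'a::topological_space \<Rightarrow>\<^sub>C 'b::real_normed_vector. apply_bcontfun u x)"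
  by (rule bounded_linear_intro[where K = 1]) (auto simp: norm_bounded)

text \<open>The function exp(t) (h(t) - a) has derivative exp(t) (p(t) - a) \<ge> 0, hence is
  nondecreasing.\<close>

lemma relaxation_lower_bound:
  fixes h p :: "real \<Rightarrow> real"
  assumes h: "\<And>t. 0 \<le> t \<Longrightarrow> (h has_real_derivative p t - h t) (at t within {0..})"
    and p: "\<And>t. 0 \<le> t \<Longrightarrow> a \<le> p t" and t: "0 \<le> t"
  shows "exp (- t) * (h 0 - a) \<le> h t - a"
proof -
  have "exp 0 * (h 0 - a) \<le> exp t * (h t - a)"
  proof (rule DERIV_nonneg_imp_increasing_open[where f = "\<lambda>s. exp s * (h s - a)"])
    fix s :: real assume s: "0 < s" "s < t"
    have "at s within {0..} = at s" using s by (intro at_within_interior) auto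
    then have "(h has_real_derivative p s - h s) (at s)" using h[of s] s by simp
    then have "((\<lambda>s. exp s * (h s - a)) has_real_derivative exp s * (p s - a)) (at s)"
      by (auto intro!: derivative_eq_intros simp: algebra_simps)
    then show "\<exists>y. ((\<lambda>s. exp s * (h s - a)) has_real_derivative y) (at s) \<and> 0 \<le> y"
      using p[of s] s by (intro exI[of _ "exp s * (p s - a)"]) auto
  next
    have "continuous_on {0..} h" by (rule DERIV_continuous_on) (rule h, simp)
    then have "continuous_on {0..t} h" by (rule continuous_on_subset) auto
    then show "continuous_on {0..t} (\<lambda>s. exp s * (h s - a))" by (intro continuous_intros)
  qed (rule t)
  then show ?thesis by (simp add: exp_minus field_simps)
qed

text \<open>Multiplying the difference by exp(t) removes the damping term, so Gronwall applies with
  constant L. Applied directly to \<open>F u - u\<close> it would only give the rate L + 1, which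
  never decays.\<close>

lemma relaxation_dist_le:
  fixes u v :: "real \<Rightarrow> 'b::real_normed_vector"
  assumes F: "L-lipschitz_on UNIV F"
    and u: "\<And>t. 0 \<le> t \<Longrightarrow> (u has_vector_derivative F (u t) - u t) (at t within {0..})"
    and v: "\<And>t. 0 \<le> t \<Longrightarrow> (v has_vector_derivative F (v t) - v t) (at t within {0..})"
    and t: "0 \<le> t"
  shows "norm (u t - v t) \<le> exp ((L - 1) * t) * norm (u 0 - v 0)"
proof -
  define z where "z t = exp t *\<^sub>R (u t - v t)" for t
  have "norm (z t) \<le> exp (L * t) * norm (z 0)"
  proof (rule gronwall_norm[OF lipschitz_on_nonneg[OF F] _ _ t])
    fix s :: real assume s: "0 \<le> s"
    have "((\<lambda>s. exp s) has_real_derivative exp s) (at s within {0..})"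
      by (auto intro!: derivative_eq_intros)
    from has_vector_derivative_scaleR[OF this has_vector_derivative_diff[OF u[OF s] v[OF s]]]
    show "(z has_vector_derivative exp s *\<^sub>R (F (u s) - F (v s))) (at s within {0..})"
      unfolding z_def by (simp add: algebra_simps)
    show "norm (exp s *\<^sub>R (F (u s) - F (v s))) \<le> L * norm (z s)"
      using lipschitz_onD[OF F, of "u s" "v s"] by (simp add: z_def dist_norm)
  qed
  then have "exp t * norm (u t - v t) \<le> exp (L * t) * norm (u 0 - v 0)" by (simp add: z_def)
  moreover have "exp ((L - 1) * t) = exp (L * t) / exp t" by (simp add: left_diff_distrib exp_diff)
  ultimately show ?thesis by (simp add: pos_le_divide_eq mult.commute)
qed

theorem lemma3p2:
  fixes \<psi> :: "'a::polish_space \<Rightarrow> real"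
    and b :: "'a \<Rightarrow> ('a \<Rightarrow> nat) measure"
    and \<beta> :: "'a \<Rightarrow> 'a measure"
    and \<delta>_star m :: real
    and \<phi> :: "'a \<Rightarrow>\<^sub>C real"
  assumes loc_compact: "locally_compact_space (euclidean :: 'a topology)"
    and psi_cont: "continuous_on UNIV \<psi>"
    and psi_range: "\<And>x. 0 < \<psi> x \<and> \<psi> x \<le> 1"
    and psi_vanish: "\<And>\<epsilon>. \<epsilon> > 0 \<Longrightarrow> \<exists>\<Lambda>. compact \<Lambda> \<and> (\<forall>x. x \<notin> \<Lambda> \<longrightarrow> \<psi> x < \<epsilon>)"
    and psi_inf: "\<And>\<Lambda>. compact \<Lambda> \<Longrightarrow> \<Lambda> \<noteq> {} \<Longrightarrow> 0 < (INF x\<in>\<Lambda>. \<psi> x)"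
    and kernel: "b \<in> borel \<rightarrow>\<^sub>M prob_algebra vague_borel"
    and kernel_fin: "\<And>x. measure (b x) fin_configs = 1"
    and beta: "is_first_moment_kernel b \<beta>"
    and A1: "\<And>g. g \<in> bcontfun \<Longrightarrow> (\<And>x. 0 \<le> g x) \<Longrightarrow> Phi b (\<lambda>x. exp (- g x * \<psi> x)) \<in> bcontfun"
    and A2: "(SUP x. mean_offspring b x) < \<infinity>"
    and A3: "\<delta>_star > 0" "\<And>x. death_prob b x \<ge> 1 - \<psi> x \<and> 1 - \<psi> x \<ge> \<delta>_star"
    and A4: "m > 0"
      "\<And>x. (\<integral>\<^sup>+y. ennreal (\<psi> y) \<partial>\<beta> x) \<le> mean_offspring b x * ennreal m * ennreal (\<psi> x)"
    and phi: "\<phi> \<in> C_psi \<psi> b"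
  shows "\<exists>u. classical_solution b \<phi> u \<and> (\<forall>t\<ge>0. u t \<in> C_psi \<psi> b) \<and>
           (\<forall>v. classical_solution b \<phi> v \<and> (\<forall>t\<ge>0. v t \<in> C_psi \<psi> b) \<longrightarrow> (\<forall>t\<ge>0. v t = u t)) \<and>
           (\<forall>c>0. (\<forall>x. c * \<psi> x \<le> 1 - \<phi> x \<and> 1 - \<phi> x \<le> 1 - death_prob b x) \<longrightarrow>
              (\<forall>t\<ge>0. \<forall>x. c * exp (- t) * \<psi> x \<le> 1 - u t x \<and> 1 - u t x \<le> \<psi> x)) \<and>
           ((SUP x. mean_offspring b x) < 1 \<longrightarrow> (u \<longlongrightarrow> const_bcontfun 1) at_top)"
proof -

  \<comment> \<open>Constants and measurability extracted from the assumptions\<close>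
  define L where "L = enn2real (SUP x. mean_offspring b x)"
  have L0: "0 \<le> L" by (simp add: L_def)
  \<comment> \<open>By \<open>A2\<close> the supremum is finite, so \<open>enn2real\<close> loses
    nothing.\<close>
  have L: "mean_offspring b x \<le> ennreal L" for x
    using A2 unfolding L_def by (subst ennreal_enn2real) (auto intro: SUP_upper)
  have bx: "sets (b x) = sets vague_borel" "prob_space (b x)" for x
    using measurable_space[OF kernel, of x] by (auto simp: space_prob_algebra)
  \<comment> \<open>A set outside the \<sigma>-algebra would have measure 0, while
    \<open>kernel_fin\<close> says 1.\<close>
  have fin: "fin_configs \<in> sets (vague_borel :: ('a \<Rightarrow> nat) measure)"
    using kernel_fin[of undefined] measure_notin_sets[of fin_configs "b undefined"] bx(1) by force
  have psi0: "\<And>x. 0 < \<psi> x" using psi_range by blast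
  \<comment> \<open>The particle number is the configuration sum of the constant 1.\<close>
  have size: "(\<lambda>\<xi>. of_nat (config_size \<xi>) * indicator fin_configs \<xi> :: ennreal) \<in> borel_measurable (b x)" for x
  proof -
    have "(\<lambda>\<xi>. ennreal (if \<xi> \<in> fin_configs then config_sum \<xi> (\<lambda>_. 1) else 0))
        \<in> borel_measurable (vague_borel :: ('a \<Rightarrow> nat) measure)"
      using measurable_config_sum_fin_configs[OF psi_cont psi0 psi_vanish fin continuous_on_const, of 1]
      by (rule measurable_compose[OF _ measurable_ennreal])
    moreover have "ennreal (if \<xi> \<in> fin_configs then config_sum \<xi> (\<lambda>_. 1) else 0)
        = of_nat (config_size \<xi>) * indicator fin_configs \<xi>" for \<xi> :: "'a \<Rightarrow> nat"
      by (auto simp: config_sum_finite config_size_def ennreal_of_nat_eq_real_of_nat)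
    ultimately show ?thesis by (simp cong: measurable_cong_sets add: bx(1))
  qed

  \<comment> \<open>The admissible functions: they contain \<open>C_psi\<close> and all truncations
    below, and stay above \<open>\<delta>_star\<close>.\<close>
  define D where "D f \<longleftrightarrow> continuous_on UNIV f \<and> (\<forall>x. 1 - \<psi> x \<le> f x \<and> f x \<le> 1)" for f
  have Dge: "\<delta>_star \<le> f x" if "D f" for f x
    using that A3(2)[of x] by (auto simp: D_def intro: order_trans)
  have Dpos: "0 < f x" if "D f" for f x
    using Dge[OF that, of x] A3(1) by simp
  have D01: "0 \<le> f x \<and> f x \<le> 1" if "D f" for f x
    using Dpos[OF that, of x] that by (auto simp: D_def)
  have meas: "(\<lambda>\<xi>. config_prod \<xi> f) \<in> borel_measurable (b x)" if "D f" for f x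
  proof -
    have "(\<lambda>\<xi>. config_prod \<xi> f) \<in> borel_measurable vague_borel"
      using that Dpos[OF that]
      by (intro measurable_config_prod[OF psi_cont psi0 psi_vanish fin]) (auto simp: D_def)
    then show ?thesis by (simp cong: measurable_cong_sets add: bx(1))
  qed
  have Phi_bcont: "Phi b f \<in> bcontfun" if f: "D f" for f
  proof -
    \<comment> \<open>Chosen so that f = exp(-g \<psi>). It stays bounded although \<psi> vanishes
      at infinity: -ln f \<le> (1 - f)/f \<le> \<psi> / \<open>\<delta>_star\<close> cancels the
      division by \<psi>.\<close>
    define g where "g x = - ln (f x) / \<psi> x" for x
    have "0 \<le> g x \<and> g x \<le> 1 / \<delta>_star" for x
    proof
      show "0 \<le> g x"
        using D01[OF f, of x] Dpos[OF f, of x] psi0[of x] unfolding g_def by (intro divide_nonneg_pos) auto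
      have "- ln (f x) = ln (1 / f x)" using Dpos[OF f, of x] by (simp add: ln_div)
      also have "\<dots> \<le> 1 / f x - 1" using Dpos[OF f, of x] by (intro ln_le_minus_one) simp
      also have "\<dots> = (1 - f x) / f x" using Dpos[OF f, of x] by (simp add: field_simps)
      also have "\<dots> \<le> \<psi> x / \<delta>_star"
        using f Dge[OF f, of x] A3(1) psi0[of x] by (intro frac_le) (auto simp: D_def algebra_simps intro: less_imp_le)
      finally show "g x \<le> 1 / \<delta>_star"
        using psi0[of x] by (simp add: g_def field_simps)
    qed
    note gb = this
    have "continuous_on UNIV g"
      unfolding g_def using f Dpos[OF f] psi0
      by (intro continuous_intros continuous_on_ln psi_cont) (auto simp: D_def less_imp_neq[symmetric])
    then have "g \<in> bcontfun" using gb by (intro bcontfun_normI[of g "1 / \<delta>_star"]) auto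
    from A1[OF this] gb have "Phi b (\<lambda>x. exp (- g x * \<psi> x)) \<in> bcontfun" by blast
    moreover have "exp (- g x * \<psi> x) = f x" for x
      using psi0[of x] Dpos[OF f, of x] by (simp add: g_def)
    ultimately show ?thesis by simp
  qed
  have Phi_le: "Phi b f x \<le> 1" and Phi_ge: "death_prob b x \<le> Phi b f x" if "D f" for f x
    using Phi_bounds[of b x f, OF bx(2) meas[OF that] D01[OF that]] by auto

  \<comment> \<open>Truncating to \<open>[1 - \<psi>, 1]\<close> makes the right-hand side globally Lipschitz; the lower barrier must
    be continuous, and \<open>\<delta>\<close> need not be.\<close>
  define P where "P u x = min 1 (max (1 - \<psi> x) (apply_bcontfun u x))" for u :: "'a \<Rightarrow>\<^sub>C real" and x
  have DP: "D (P u)" for u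
  proof -
    have "continuous_on UNIV (P u)"
      unfolding P_def by (intro continuous_intros psi_cont continuous_on_apply_bcontfun)
    then show ?thesis using psi0 by (auto simp: D_def P_def intro: less_imp_le)
  qed
  have P_id: "P u = apply_bcontfun u" if "D u" for u :: "'a \<Rightarrow>\<^sub>C real"
    using that by (auto simp: D_def P_def fun_eq_iff)
  define F where "F u = Bcontfun (Phi b (P u))" for u
  have F: "apply_bcontfun (F u) = Phi b (P u)" for u :: "'a \<Rightarrow>\<^sub>C real"
    using Phi_bcont[OF DP] by (simp add: F_def Bcontfun_inverse)
  have Flip: "L-lipschitz_on UNIV F"
  proof (rule lipschitz_onI[OF _ L0])
    fix u v
    show "dist (F u) (F v) \<le> L * dist u v"
    proof (rule dist_bound)
      fix x
      \<comment> \<open>Clipping both functions at the same barriers is nonexpansive.\<close>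
      have "\<bar>P u y - P v y\<bar> \<le> dist u v" for y
        using dist_bounded[of u y v] unfolding P_def dist_real_def by linarith
      then show "dist (F u x) (F v x) \<le> L * dist u v"
        unfolding F dist_real_def
        by (intro Phi_diff_le[OF bx(2) kernel_fin meas[OF DP] meas[OF DP] size D01[OF DP] D01[OF DP] _ _ L L0]) auto
    qed
  qed
  \<comment> \<open>This crude constant serves existence only; comparison of solutions uses the rate
    \<open>L - 1\<close>.\<close>
  have "(L + 1)-lipschitz_on UNIV (\<lambda>u. F u - u)"
    by (intro lipschitz_on_diff Flip lipschitz_on_id)
  then obtain u where u0: "u 0 = \<phi>"
    and u: "\<And>t. 0 \<le> t \<Longrightarrow> (u has_vector_derivative F (u t) - u t) (at t within {0..})"
    using lipschitz_ode_solution[of "L + 1" "\<lambda>u. F u - u" \<phi>] by blast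

  \<comment> \<open>A priori bounds for the truncated solution\<close>
  have ux: "((\<lambda>t. u t x) has_real_derivative F (u t) x - u t x) (at t within {0..})" if "0 \<le> t" for t x
    using bounded_linear.has_vector_derivative[OF bounded_linear_apply_bcontfun u[OF that], of x]
    by (simp add: has_real_derivative_iff_has_vector_derivative)
  have phiD: "death_prob b x \<le> \<phi> x" for x using phi by (auto simp: C_psi_def)
  \<comment> \<open>Every \<open>P u\<close> is admissible, so the bounds on \<Phi> hold before the
    truncation is known to be inactive.\<close>
  have u_ge: "death_prob b x \<le> u t x" if "0 \<le> t" for t x
  proof -
    have "exp (- t) * (u 0 x - death_prob b x) \<le> u t x - death_prob b x"
      by (rule relaxation_lower_bound[OF ux _ that]) (auto simp: F intro: Phi_ge[OF DP])
    moreover have "0 \<le> exp (- t) * (u 0 x - death_prob b x)" using phiD[of x] by (simp add: u0)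
    ultimately show ?thesis by linarith
  qed
  have u_le: "exp (- t) * (1 - \<phi> x) \<le> 1 - u t x" if "0 \<le> t" for t x
  proof -
    \<comment> \<open>The lower bound for -u with a = -1 is the upper bound for u.\<close>
    have "exp (- t) * (- u 0 x - (-1)) \<le> - u t x - (-1)"
    proof (rule relaxation_lower_bound[where p = "\<lambda>t. - F (u t) x", OF _ _ that])
      fix s :: real assume "0 \<le> s"
      from DERIV_minus[OF ux[OF this, of x]]
      show "((\<lambda>t. - u t x) has_real_derivative - F (u s) x - (- u s x)) (at s within {0..})" by simp
      show "- 1 \<le> - F (u s) x" using Phi_le[OF DP] by (simp add: F)
    qed
    then show ?thesis by (simp add: u0)
  qed
  have bounds: "c * exp (- t) * \<psi> x \<le> 1 - u t x"
    if "0 \<le> t" "\<And>x. c * \<psi> x \<le> 1 - \<phi> x" for c t x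
  proof -
    have "exp (- t) * (c * \<psi> x) \<le> exp (- t) * (1 - \<phi> x)" using that by (intro mult_left_mono) auto
    also have "\<dots> \<le> 1 - u t x" by (rule u_le[OF that(1)])
    finally show ?thesis by (simp add: ac_simps)
  qed
  have uC: "u t \<in> C_psi \<psi> b" if t: "0 \<le> t" for t
  proof -
    obtain c where c: "c > 0" "\<And>x. c * \<psi> x \<le> 1 - \<phi> x" using phi by (auto simp: C_psi_def)
    \<comment> \<open>The witness decays in \<open>t\<close>, but \<open>C_psi\<close> only asks for
      a positive constant at each time.\<close>
    have "\<forall>x. c * exp (- t) * \<psi> x \<le> 1 - u t x \<and> 1 - u t x \<le> 1 - death_prob b x"
      using bounds[OF t c(2)] u_ge[OF t] by simp
    then show ?thesis using c(1) unfolding C_psi_def by (auto intro!: exI[of _ "c * exp (- t)"])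
  qed
  \<comment> \<open>By \<open>A3\<close>, 1 - \<psi> \<le> \<delta> \<le> w, so \<open>P\<close>
    leaves members of \<open>C_psi\<close> unchanged.\<close>
  have CD: "D w" if w: "w \<in> C_psi \<psi> b" for w :: "'a \<Rightarrow>\<^sub>C real"
  proof -
    obtain c where c: "c > 0" "\<And>x. c * \<psi> x \<le> 1 - w x \<and> 1 - w x \<le> 1 - death_prob b x"
      using w by (auto simp: C_psi_def)
    have "1 - \<psi> x \<le> w x \<and> w x \<le> 1" for x
    proof -
      have "0 < c * \<psi> x" using c(1) psi0[of x] by simp
      then show ?thesis using c(2)[of x] A3(2)[of x] by linarith
    qed
    then show ?thesis by (simp add: D_def)
  qed
  have FC: "(F w - w) x = - w x + Phi b w x" if "w \<in> C_psi \<psi> b" for w :: "'a \<Rightarrow>\<^sub>C real" and x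
    using P_id[OF CD[OF that]] by (simp add: F)

  \<comment> \<open>Return to the original equation: solution, uniqueness and limit\<close>
  have "continuous_on {0..} u"
    by (rule continuous_on_vector_derivative) (rule u, simp)
  then have "continuous_on {0..} (\<lambda>t. F (u t) - u t)"
    by (intro continuous_on_diff continuous_on_compose2[OF lipschitz_on_continuous_on[OF Flip]]) auto
  then have sol: "classical_solution b \<phi> u"
    unfolding classical_solution_def using u0 u FC[OF uC] by (intro conjI exI[of _ "\<lambda>t. F (u t) - u t"]) auto
  have unique: "v t = u t"
    if v: "classical_solution b \<phi> v" "\<And>t. 0 \<le> t \<Longrightarrow> v t \<in> C_psi \<psi> b" and t: "0 \<le> t" for v t
  proof -
    obtain v' where v0: "v 0 = \<phi>"
      and v': "\<And>t. 0 \<le> t \<Longrightarrow> (v has_vector_derivative v' t) (at t within {0..})"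
        "\<And>t x. 0 \<le> t \<Longrightarrow> v' t x = - v t x + Phi b (v t) x"
      using v(1) by (auto simp: classical_solution_def)
    \<comment> \<open>Since \<open>v s\<close> lies in \<open>C_psi\<close>, a competitor also
      solves the truncated equation, where \<open>relaxation_dist_le\<close> applies.\<close>
    have "v' s = F (v s) - v s" if "0 \<le> s" for s
      using v'(2)[OF that] FC[OF v(2)[OF that]] by (intro bcontfun_eqI) simp
    then have "(v has_vector_derivative F (v s) - v s) (at s within {0..})" if "0 \<le> s" for s
      using v'(1)[OF that] that by simp
    from relaxation_dist_le[OF Flip this u t] show ?thesis by (simp add: u0 v0)
  qed
  have conv: "(u \<longlongrightarrow> const_bcontfun 1) at_top" if "(SUP x. mean_offspring b x) < 1"
  proof -
    have "L < 1" using that unfolding L_def by (cases "SUP x. mean_offspring b x") auto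
    \<comment> \<open>The constant 1 is not in \<open>C_psi\<close>, but it is admissible and
      stationary for the truncated equation, so it can be compared with \<open>u\<close>.\<close>
    have one: "D (const_bcontfun 1)" using psi0 by (auto simp: D_def intro: less_imp_le)
    have "F (const_bcontfun 1) = const_bcontfun 1"
    proof (rule bcontfun_eqI)
      fix x
      show "F (const_bcontfun 1) x = const_bcontfun 1 x"
        unfolding F P_id[OF one] using prob_space.prob_space[OF bx(2)]
        by (simp add: Phi_def config_prod_one)
    qed
    then have one_sol: "((\<lambda>_. const_bcontfun 1) has_vector_derivative F (const_bcontfun 1) - const_bcontfun 1) (at t within {0..})"
      for t :: real
      by simp
    have "norm (u t - const_bcontfun 1) \<le> exp ((L - 1) * t) * norm (u 0 - const_bcontfun 1)"
      if "0 \<le> t" for t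
      using relaxation_dist_le[OF Flip, of u "\<lambda>_. const_bcontfun 1", OF u one_sol that] by simp
    then have ev: "\<forall>\<^sub>F t in at_top. norm (u t - const_bcontfun 1) \<le> exp ((L - 1) * t) * norm (u 0 - const_bcontfun 1)"
      by (rule eventually_at_top_linorderI)
    have "((\<lambda>t. exp ((L - 1) * t)) \<longlongrightarrow> 0) at_top"
      by (rule filterlim_compose[OF exp_at_bot filterlim_tendsto_neg_mult_at_bot[OF tendsto_const _ filterlim_ident]])
        (use \<open>L < 1\<close> in simp)
    then have "((\<lambda>t. exp ((L - 1) * t) * norm (u 0 - const_bcontfun 1)) \<longlongrightarrow> 0) at_top"
      by (rule tendsto_mult_left_zero)
    from Lim_null_comparison[OF ev this] show ?thesis by (rule LIM_zero_cancel)
  qed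
  have upper: "1 - u t x \<le> \<psi> x" if "0 \<le> t" for t x
    using u_ge[OF that, of x] A3(2)[of x] by linarith
  show ?thesis
    using sol uC unique bounds upper conv by (intro exI[of _ u]) blast
qed

end
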